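(* Let $k\ge 2$ and let $G$ be a connected bipartite circulant on $2n$ vertices. If $G\simeq I+P^{i_2}+\cdots+P^{i_k}$ with $0<i_2<\cdots<i_k\leq n-1$, then $Z(G)\leq 2i_k$.
   Context: An $n\times n$ $(0,1)$-matrix $A$ is the biadjacency matrix of a bipartite graph on $2n$ vertices: there is one vertex for each row and one for each column, and a row vertex and a column vertex are adjacent if and only if the corresponding entry of $A$ is $1$. $G\simeq A$ means that $A$ is a biadjacency matrix of $G$ for some labeling of its vertices. A square matrix is circulant if each row is the row above it shifted one position to the right, the last entry wrapping to the first column. A bipartite circulant is a bipartite graph obtained from a square $(0,1)$ circulant matrix. $P$ is the $n\times n$ permutation matrix of the $n$-cycle $(1\ 2\ \cdots\ n)$, with ones in positions $(r,r+1)$ (indices mod $n$); $I=P^0$ is the identity. Zero forcing: color the vertices of a set $B\subseteq V(G)$ black and the others white. A black vertex $v$ may force a white neighbor $w$ to become black if $w$ is the unique white neighbor of $v$. $B$ is a zero forcing set if repeated applications of this rule eventually make all vertices black. $Z(G)$ is the minimum size of a zero forcing set of $G$. *)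

theory Defs
  imports
    "Jordan_Normal_Form.Matrix"
    "Graph_Theory.Digraph_Component"
begin

text \<open>
  Simple undirected graphs are the finite, loop-free, symmetric digraphs without parallel arcs
  of the locale \<^locale>\<open>graph\<close>; \<open>u \<rightarrow>\<^bsub>G\<^esub> v\<close> is then the (symmetric) adjacency relation.
  Matrix rows and columns are indexed from 0.
\<close>

subsection \<open>Biadjacency matrices and circulants\<close>

definition zero_one_mat :: "int mat \<Rightarrow> bool" where
  "zero_one_mat A \<longleftrightarrow> elements_mat A \<subseteq> {0, 1}"

definition biadjacency_labeling ::
  "('v, 'e) pre_digraph \<Rightarrow> int mat \<Rightarrow> (nat \<Rightarrow> 'v) \<Rightarrow> (nat \<Rightarrow> 'v) \<Rightarrow> bool"
where
  "biadjacency_labeling G A rv cv \<longleftrightarrow>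
     inj_on rv {..<dim_row A} \<and> inj_on cv {..<dim_col A} \<and>
     rv ` {..<dim_row A} \<inter> cv ` {..<dim_col A} = {} \<and>
     verts G = rv ` {..<dim_row A} \<union> cv ` {..<dim_col A} \<and>
     (\<forall>r < dim_row A. \<forall>c < dim_col A. rv r \<rightarrow>\<^bsub>G\<^esub> cv c \<longleftrightarrow> A $$ (r, c) = 1) \<and>
     (\<forall>r < dim_row A. \<forall>r' < dim_row A. \<not> rv r \<rightarrow>\<^bsub>G\<^esub> rv r') \<and>
     (\<forall>c < dim_col A. \<forall>c' < dim_col A. \<not> cv c \<rightarrow>\<^bsub>G\<^esub> cv c')"

text \<open>The relation usually written \<open>G \<simeq> A\<close>.\<close>

definition has_biadjacency_matrix :: "('v, 'e) pre_digraph \<Rightarrow> int mat \<Rightarrow> bool" where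
  "has_biadjacency_matrix G A \<longleftrightarrow>
     graph G \<and> square_mat A \<and> zero_one_mat A \<and> (\<exists>rv cv. biadjacency_labeling G A rv cv)"

definition circulant_mat :: "int mat \<Rightarrow> bool" where
  "circulant_mat A \<longleftrightarrow> square_mat A \<and>
     (\<forall>r c. Suc r < dim_row A \<longrightarrow> c < dim_col A \<longrightarrow>
        A $$ (Suc r, Suc c mod dim_col A) = A $$ (r, c))"

definition bipartite_circulant :: "('v, 'e) pre_digraph \<Rightarrow> bool" where
  "bipartite_circulant G \<longleftrightarrow> (\<exists>A. circulant_mat A \<and> has_biadjacency_matrix G A)"

definition cycle_perm_mat :: "nat \<Rightarrow> int mat" where
  "cycle_perm_mat n = mat n n (\<lambda>(r, c). if c = Suc r mod n then 1 else 0)"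

subsection \<open>Zero forcing\<close>

definition can_force :: "('v, 'e) pre_digraph \<Rightarrow> 'v set \<Rightarrow> 'v \<Rightarrow> 'v \<Rightarrow> bool" where
  "can_force G S v w \<longleftrightarrow> v \<in> S \<and> {u. v \<rightarrow>\<^bsub>G\<^esub> u \<and> u \<notin> S} = {w}"

definition force_step :: "('v, 'e) pre_digraph \<Rightarrow> 'v set \<Rightarrow> 'v set \<Rightarrow> bool" where
  "force_step G S S' \<longleftrightarrow> (\<exists>v w. can_force G S v w \<and> S' = insert w S)"

definition zero_forcing_set :: "('v, 'e) pre_digraph \<Rightarrow> 'v set \<Rightarrow> bool" where
  "zero_forcing_set G B \<longleftrightarrow> B \<subseteq> verts G \<and> (force_step G)\<^sup>*\<^sup>* B (verts G)"

definition zero_forcing_number :: "('v, 'e) pre_digraph \<Rightarrow> nat" where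
  "zero_forcing_number G = (LEAST m. \<exists>B. zero_forcing_set G B \<and> card B = m)"

end

theory Submission
  imports Defs
begin

text \<open>
  Write \<open>m = i\<^sub>k\<close>. The first \<open>m\<close> row vertices and the first \<open>m\<close> column vertices form a zero forcing
  set. Indeed, suppose that rows and columns \<open>0, \<dots>, t - 1\<close> are black with \<open>m \<le> t < n\<close>. Row \<open>t - m\<close> is
  adjacent to column \<open>t\<close> and otherwise only to columns in \<open>{t - m..<t}\<close>, so it forces column \<open>t\<close>;
  then column \<open>t\<close> is adjacent to row \<open>t\<close> and otherwise only to rows in \<open>{t - m..<t}\<close>, so it
  forces row \<open>t\<close>. No index wraps around because \<open>m \<le> t < n\<close>.
\<close>

lemma index_finsum_mat:
  assumes "finite J" "\<And>j. j \<in> J \<Longrightarrow> M j \<in> carrier_mat nr nc" "r < nr" "c < nc"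
  shows "finsum (module_mat TYPE('a::comm_ring_1) nr nc) M J $$ (r, c) = (\<Sum>j\<in>J. M j $$ (r, c))"
  using assms(1,2)
proof (induction J rule: finite_induct)
  case empty
  interpret abelian_group "module_mat TYPE('a) nr nc" by (rule abelian_group_mat)
  show ?case using assms(3,4) by (simp add: module_mat_simps)
next
  case (insert j J)
  interpret abelian_group "module_mat TYPE('a) nr nc" by (rule abelian_group_mat)
  have M: "M \<in> J \<rightarrow> carrier (module_mat TYPE('a) nr nc)" "M j \<in> carrier (module_mat TYPE('a) nr nc)"
    using insert.prems by (auto simp: module_mat_simps)
  have "finsum (module_mat TYPE('a) nr nc) M J \<in> carrier_mat nr nc"
    using finsum_closed[OF M(1)] by (simp add: module_mat_simps)
  then show ?case
    using insert assms(3,4) finsum_insert[OF insert.hyps M] by (simp add: module_mat_simps)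
qed

text \<open>Each further factor moves the single 1 of a row cyclically one column to the
  right.\<close>

lemma cycle_perm_mat_pow:
  "cycle_perm_mat n ^\<^sub>m e = mat n n (\<lambda>(r, c). if c = (r + e) mod n then 1 else 0)"
proof (induction e)
  case 0
  show ?case by (auto simp: cycle_perm_mat_def)
next
  case (Suc e)
  show ?case
  proof (rule eq_matI)
    fix r c
    assume "r < dim_row (mat n n (\<lambda>(r, c). if c = (r + Suc e) mod n then 1 else 0))"
      and "c < dim_col (mat n n (\<lambda>(r, c). if c = (r + Suc e) mod n then 1 else 0))"
    then have rc: "r < n" "c < n" by auto
    have "(cycle_perm_mat n ^\<^sub>m Suc e) $$ (r, c)
        = (\<Sum>l = 0..<n. (if l = (r + e) mod n then 1 else 0) * (if c = Suc l mod n then 1 else 0))"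
      using rc by (simp add: Suc) (simp add: cycle_perm_mat_def scalar_prod_def)
    \<comment> \<open>Only \<open>l = (r + e) mod n\<close> contributes; this is the shape that
      \<open>sum.delta'\<close> collapses.\<close>
    also have "\<dots> = (\<Sum>l = 0..<n. if l = (r + e) mod n then (if c = Suc l mod n then 1 else 0) else 0)"
      by (rule sum.cong) auto
    also have "\<dots> = (if c = Suc ((r + e) mod n) mod n then 1 else 0)"
      using rc by (simp add: sum.delta')
    finally show "(cycle_perm_mat n ^\<^sub>m Suc e) $$ (r, c)
        = mat n n (\<lambda>(r, c). if c = (r + Suc e) mod n then 1 else 0) $$ (r, c)"
      using rc by (simp add: mod_Suc_eq)
  qed (simp_all add: Suc cycle_perm_mat_def)
qed

text \<open>Passing to the closure absorbs the case that \<open>w\<close> is already black, where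
  zero steps suffice. So no use of the rule has to show that \<open>w\<close> is white.\<close>

lemma force_stepI:
  assumes "v \<in> S" "v \<rightarrow>\<^bsub>G\<^esub> w" "\<And>u. v \<rightarrow>\<^bsub>G\<^esub> u \<Longrightarrow> u \<in> insert w S"
  shows "(force_step G)\<^sup>*\<^sup>* S (insert w S)"
proof (cases "w \<in> S")
  case True
  then show ?thesis by (simp add: insert_absorb)
next
  case False
  then have "can_force G S v w" using assms by (auto simp: can_force_def)
  then show ?thesis by (intro r_into_rtranclp) (auto simp: force_step_def)
qed

text \<open>This isolates what the forcing order demands of a matrix. The conditions
  \<open>row\<close> and \<open>col\<close> are one-sided, since at stage \<open>t\<close> every
  index below \<open>t\<close> is already black. They concern only rows with
  \<open>r + m < n\<close> and columns with \<open>m \<le> c\<close>, the ones that act as forcing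
  vertices; elsewhere the band of a circulant may wrap around.\<close>

lemma zero_forcing_number_le_banded:
  assumes "graph G" and lab: "biadjacency_labeling G A rv cv"
    and A: "A \<in> carrier_mat n n" and m: "0 < m" "m \<le> n"
    and one: "\<And>r. r + m < n \<Longrightarrow> A $$ (r, r + m) = 1"
    and row: "\<And>r c. r + m < n \<Longrightarrow> c < n \<Longrightarrow> A $$ (r, c) = 1 \<Longrightarrow> c \<le> r + m"
    and col: "\<And>r c. r < n \<Longrightarrow> c < n \<Longrightarrow> m \<le> c \<Longrightarrow> A $$ (r, c) = 1 \<Longrightarrow> r \<le> c"
    and diag: "\<And>r. r < n \<Longrightarrow> A $$ (r, r) = 1"
  shows "zero_forcing_number G \<le> 2 * m"
proof -
  interpret graph G by fact
  define B where "B t = rv ` {..<t} \<union> cv ` {..<t}" for t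
  have dims: "dim_row A = n" "dim_col A = n" using A by auto
  have inj: "inj_on rv {..<n}" "inj_on cv {..<n}" and disj: "rv ` {..<n} \<inter> cv ` {..<n} = {}"
    and verts: "verts G = B n"
    and rc: "\<And>r c. r < n \<Longrightarrow> c < n \<Longrightarrow> rv r \<rightarrow>\<^bsub>G\<^esub> cv c \<longleftrightarrow> A $$ (r, c) = 1"
    and rr: "\<And>r r'. r < n \<Longrightarrow> r' < n \<Longrightarrow> \<not> rv r \<rightarrow>\<^bsub>G\<^esub> rv r'"
    and cc: "\<And>c c'. c < n \<Longrightarrow> c' < n \<Longrightarrow> \<not> cv c \<rightarrow>\<^bsub>G\<^esub> cv c'"
    using lab unfolding biadjacency_labeling_def dims B_def by auto
  have in_B: "u \<in> rv ` {..<n} \<union> cv ` {..<n}" if "v \<rightarrow>\<^bsub>G\<^esub> u" for u v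
    using adj_in_verts(2)[OF that] by (simp add: verts B_def)
  have step: "(force_step G)\<^sup>*\<^sup>* (B t) (B (Suc t))" if t: "m \<le> t" "t < n" for t
  proof -
    define S where "S = insert (cv t) (B t)"
    have 1: "(force_step G)\<^sup>*\<^sup>* (B t) S"
      unfolding S_def
    proof (rule force_stepI)
      \<comment> \<open>\<open>0 < m\<close> puts \<open>t - m\<close> strictly below
        \<open>t\<close>; \<open>m \<le> t\<close> keeps the truncated subtraction exact, so that
        \<open>t - m + m = t\<close> below.\<close>
      show "rv (t - m) \<in> B t" using m t by (auto simp: B_def)
      show "rv (t - m) \<rightarrow>\<^bsub>G\<^esub> cv t" using rc[of "t - m" t] one[of "t - m"] t by auto
      fix u assume u: "rv (t - m) \<rightarrow>\<^bsub>G\<^esub> u"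
      then obtain c where c: "c < n" "u = cv c"
        using in_B[OF u] rr[of "t - m"] t by auto
      then have "c \<le> t" using u rc[of "t - m" c] row[of "t - m" c] t by auto
      then show "u \<in> insert (cv t) (B t)" using c by (cases "c = t") (auto simp: B_def)
    qed
    have "(force_step G)\<^sup>*\<^sup>* S (insert (rv t) S)"
    proof (rule force_stepI)
      show "cv t \<in> S" by (simp add: S_def)
      show "cv t \<rightarrow>\<^bsub>G\<^esub> rv t"
        using rc[of t t] diag t by (blast intro: graph_symmetric)
      fix u assume u: "cv t \<rightarrow>\<^bsub>G\<^esub> u"
      then obtain r where r: "r < n" "u = rv r" using in_B[OF u] cc[of t] t by auto
      then have "r \<le> t" using graph_symmetric[OF u] rc[of r t] col[of r t] t by auto
      then show "u \<in> insert (rv t) S" using r by (cases "r = t") (auto simp: B_def S_def)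
    qed
    moreover have "insert (rv t) S = B (Suc t)"
      by (auto simp: S_def B_def lessThan_Suc)
    ultimately show ?thesis using 1 by auto
  qed
  have "(force_step G)\<^sup>*\<^sup>* (B m) (B t)" if "m \<le> t" "t \<le> n" for t
    using that
  proof (induction t rule: dec_induct)
    case (step t)
    then show ?case using \<open>\<And>t. m \<le> t \<Longrightarrow> t < n \<Longrightarrow> (force_step G)\<^sup>*\<^sup>* (B t) (B (Suc t))\<close>[of t]
      by (simp add: rtranclp_trans)
  qed simp
  \<comment> \<open>At \<open>t = n\<close> the chain ends in \<open>B n\<close>, the whole vertex
    set; \<open>m \<le> n\<close> places \<open>B m\<close> inside it.\<close>
  then have "zero_forcing_set G (B m)"
    using m by (auto simp: zero_forcing_set_def verts B_def)
  then have "zero_forcing_number G \<le> card (B m)"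
    unfolding zero_forcing_number_def by (intro Least_le) blast
  also have "card (B m) \<le> card (rv ` {..<m}) + card (cv ` {..<m})"
    unfolding B_def by (rule card_Un_le)
  also have "\<dots> \<le> m + m"
    by (intro add_mono order_trans[OF card_image_le]) auto
  finally show ?thesis by simp
qed

theorem theorem3p4:
  fixes G :: "('v, 'e) pre_digraph" and n k :: nat and i :: "nat \<Rightarrow> nat"
  assumes "k \<ge> 2"
    and "bipartite_circulant G"
    and "Digraph_Component.connected G"
    and "card (verts G) = 2 * n"
    and "0 < i 2"
    and "strict_mono_on {2..k} i"
    and "i k \<le> n - 1"
    and "has_biadjacency_matrix G
           (1\<^sub>m n + finsum (module_mat TYPE(int) n n) (\<lambda>j. cycle_perm_mat n ^\<^sub>m i j) {2..k})"
  shows "zero_forcing_number G \<le> 2 * i k"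
proof -
  interpret abelian_group "module_mat TYPE(int) n n" by (rule abelian_group_mat)
  define F where "F = finsum (module_mat TYPE(int) n n) (\<lambda>j. cycle_perm_mat n ^\<^sub>m i j) {2..k}"
  define A where "A = 1\<^sub>m n + F"
  have P: "cycle_perm_mat n ^\<^sub>m e \<in> carrier_mat n n" for e
    by (simp add: cycle_perm_mat_pow)
  have "F \<in> carrier_mat n n"
    unfolding F_def using finsum_closed[of "\<lambda>j. cycle_perm_mat n ^\<^sub>m i j" "{2..k}"] P
    by (simp add: module_mat_simps Pi_def)
  then have A: "A \<in> carrier_mat n n" by (simp add: A_def)
  have entry: "A $$ (r, c) = (if r = c then 1 else 0)
      + (\<Sum>j\<in>{2..k}. if c = (r + i j) mod n then 1 else 0)" if "r < n" "c < n" for r c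
    using that \<open>F \<in> carrier_mat n n\<close> P
    by (simp add: A_def F_def index_finsum_mat cycle_perm_mat_pow)
  have i_le: "i j \<le> i k" if "j \<in> {2..k}" for j
    using that strict_mono_on_leD[OF assms(6), of j k] by auto
  \<comment> \<open>Because subtraction is truncated, strictness of \<open>i k < n\<close> relies on
    \<open>0 < i 2 \<le> i k\<close>, which rules out \<open>n = 0\<close>.\<close>
  have ik: "0 < i k" "i k < n"
    using assms(1,5,7) i_le[of 2] by auto
  obtain rv cv where "graph G" and 01: "zero_one_mat A" and lab: "biadjacency_labeling G A rv cv"
    using assms(8) by (auto simp: has_biadjacency_matrix_def A_def F_def)
  \<comment> \<open>Disjointness of the supports of the summands is not computed: a sum of
    nonnegative terms with one positive term is nonzero, and \<open>zero_one_mat A\<close> then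
    leaves only the value 1.\<close>
  have oneI: "A $$ (r, c) = 1" if "r < n" "c < n" "r = c \<or> (\<exists>j\<in>{2..k}. c = (r + i j) mod n)" for r c
  proof -
    have nonneg: "0 \<le> (\<Sum>j\<in>{2..k}. if c = (r + i j) mod n then 1 else 0 :: int)"
      by (rule sum_nonneg) auto
    have "A $$ (r, c) \<noteq> 0"
    proof (cases "r = c")
      case True
      then show ?thesis using entry[OF that(1,2)] nonneg by simp
    next
      case False
      then have "\<not> (\<forall>j\<in>{2..k}. (if c = (r + i j) mod n then 1 else 0 :: int) = 0)"
        using that(3) by auto
      then have "(\<Sum>j\<in>{2..k}. if c = (r + i j) mod n then 1 else 0 :: int) \<noteq> 0"
        by (subst sum_nonneg_eq_0_iff) auto
      then show ?thesis
        using False entry[OF that(1,2)] by simp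
    qed
    moreover have "A $$ (r, c) \<in> {0, 1}"
      using 01 A that unfolding zero_one_mat_def by blast
    ultimately show ?thesis by simp
  qed
  have oneD: "r = c \<or> (\<exists>j\<in>{2..k}. c = (r + i j) mod n)" if "r < n" "c < n" "A $$ (r, c) = 1" for r c
  proof (rule ccontr)
    assume "\<not> ?thesis"
    then have "A $$ (r, c) = 0" by (subst entry[OF that(1,2)]) auto
    with that show False by simp
  qed
  show ?thesis
  proof (rule zero_forcing_number_le_banded[OF \<open>graph G\<close> lab A ik(1)])
    show "A $$ (r, r + i k) = 1" if "r + i k < n" for r
      using that assms(1) by (intro oneI) (auto intro!: bexI[of _ k])
    \<comment> \<open>Here \<open>r + i j \<le> r + i k < n\<close>, so the reduction mod
      \<open>n\<close> is vacuous.\<close>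
    show "c \<le> r + i k" if "r + i k < n" "c < n" "A $$ (r, c) = 1" for r c
      using oneD[OF _ that(2,3)] that(1) i_le by fastforce
    show "r \<le> c" if "r < n" "c < n" "i k \<le> c" "A $$ (r, c) = 1" for r c
      using oneD[OF that(1,2,4)]
    proof (elim disjE bexE)
      fix j assume j: "j \<in> {2..k}" and c: "c = (r + i j) mod n"
      show "r \<le> c"
      proof (cases "r + i j < n")
        \<comment> \<open>A wrapped entry lies in column \<open>r + i j - n\<close>, which is below
          \<open>i j \<le> i k\<close> since \<open>r < n\<close>. This contradicts
          \<open>i k \<le> c\<close>.\<close>
        case False
        then have "c = r + i j - n"
          using c that(1) ik i_le[OF j] by (simp add: mod_if)
        then show ?thesis using False that(1,3) i_le[OF j] by linarith
      qed (use c in simp)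
    qed simp
    show "A $$ (r, r) = 1" if "r < n" for r using that by (intro oneI) auto
  qed (use ik in simp)
qed

end
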